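(* Let $(M,\varphi,\xi,\eta,g)$ be an almost contact B-metric manifold in $\mathcal{F}_3\oplus\mathcal{F}_7$, and let $D$ be the $\varphi$KT-connection on it given by $D_xy=\nabla_xy+\frac12T(x,y)$ with torsion $$T(x,y)=\tfrac12\bigl\{2(\nabla_x\varphi)\varphi y-(\nabla_y\varphi)\varphi x+(\nabla_{\varphi y}\varphi)x+3\eta(x)\nabla_y\xi-4\eta(y)\nabla_x\xi+2(\nabla_x\eta)y\,\xi\bigr\}.$$ Suppose that $T$ is $D$-parallel ($DT=0$) and that the curvature tensor $K$ of $D$ is of $\varphi$-Kähler type. Then the curvature tensor $R$ of $\nabla$ satisfies, for all vector fields $x,y,z,w$, $$R(x,y,\varphi z,\varphi w)=-R(x,y,z,w)-\tfrac14 g\bigl(T(x,y),\,T(z,w)+T(\varphi z,\varphi w)\bigr),$$ $$R(x,y,z,\xi)=\tfrac12 g\bigl(T(x,y),\nabla_z\xi\bigr).$$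
   Context: An almost contact B-metric manifold $(M,\varphi,\xi,\eta,g)$ is a $(2n+1)$-dimensional smooth manifold $M$ with a field of endomorphisms $\varphi$ of the tangent bundle, a vector field $\xi$, a 1-form $\eta$ and a pseudo-Riemannian metric $g$ of signature $(n,n+1)$ ($n$ negative and $n+1$ positive directions) such that $\varphi\xi=0$, $\varphi^2=-\mathrm{Id}+\eta\otimes\xi$, $\eta\circ\varphi=0$, $\eta(\xi)=1$, $g(\varphi x,\varphi y)=-g(x,y)+\eta(x)\eta(y)$. $\nabla$ is the Levi-Civita connection of $g$ and $F(x,y,z)=g((\nabla_x\varphi)y,z)$. It satisfies (P): $F(x,y,z)=F(x,z,y)=F(x,\varphi y,\varphi z)+\eta(y)F(x,\xi,z)+\eta(z)F(x,y,\xi)$. $\mathfrak{S}_{x,y,z}$ denotes the cyclic sum over $x,y,z$. Classes (conditions on $F$): $\mathcal{F}_3$: $\mathfrak{S}_{x,y,z}F(x,y,z)=0$ and $F(\xi,y,z)=F(x,y,\xi)=0$; $\mathcal{F}_7$: $\mathfrak{S}_{x,y,z}F(x,y,z)=0$ and $F(x,y,z)=-F(\varphi x,\varphi y,z)-F(\varphi x,y,\varphi z)$. The manifold is in $\mathcal{F}_3\oplus\mathcal{F}_7$ if at every point $F=F'+F''$ with $F',F''$ $(0,3)$-tensors having property (P), $F'$ satisfying the $\mathcal{F}_3$ conditions and $F''$ the $\mathcal{F}_7$ conditions. A $\varphi$KT-connection is a linear connection $D$ with $D\varphi=0$, $D\xi=0$, $D\eta=0$, $Dg=0$ whose torsion $T(x,y)=D_xy-D_yx-[x,y]$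 is such that $T(x,y,z)=g(T(x,y),z)$ is totally skew-symmetric. (On $\mathcal{F}_3\oplus\mathcal{F}_7$ the connection $D$ given in the claim is a $\varphi$KT-connection.) Curvatures: $R(x,y)z=[\nabla_x,\nabla_y]z-\nabla_{[x,y]}z$, $R(x,y,z,w)=g(R(x,y)z,w)$; $K(x,y)z=[D_x,D_y]z-D_{[x,y]}z$, $K(x,y,z,w)=g(K(x,y)z,w)$. A $(0,4)$-tensor $L$ is of $\varphi$-Kähler type if $L(x,y,z,w)=-L(y,x,z,w)=-L(x,y,w,z)$, $\mathfrak{S}_{x,y,z}L(x,y,z,w)=0$ and $L(x,y,\varphi z,\varphi w)=-L(x,y,z,w)$. *)

theory Defs
  imports "HOL-Analysis.Analysis" "HOL-Library.Function_Algebras"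
begin

section \<open>Pointwise vector space structure on functions\<close>

instantiation "fun" :: (type, real_vector) real_vector
begin

definition scaleR_fun :: "real \<Rightarrow> ('a \<Rightarrow> 'b) \<Rightarrow> 'a \<Rightarrow> 'b"
  where "scaleR_fun c f = (\<lambda>x. c *\<^sub>R f x)"

instance
  by standard (simp_all add: scaleR_fun_def fun_eq_iff scaleR_add_right scaleR_add_left)

end

definition linear_map_on :: "'a::real_vector set \<Rightarrow> ('a \<Rightarrow> 'b::real_vector) \<Rightarrow> bool" where
  "linear_map_on V f \<longleftrightarrow>
     (\<forall>u\<in>V. \<forall>v\<in>V. f (u + v) = f u + f v) \<and> (\<forall>c. \<forall>u\<in>V. f (c *\<^sub>R u) = c *\<^sub>R f u)"

definition bilinear_form_on :: "'a::real_vector set \<Rightarrow> ('a \<Rightarrow> 'a \<Rightarrow> real) \<Rightarrow> bool" where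
  "bilinear_form_on V b \<longleftrightarrow>
     (\<forall>u\<in>V. linear_map_on V (b u)) \<and> (\<forall>v\<in>V. linear_map_on V (\<lambda>u. b u v))"

definition trilinear_form_on :: "'a::real_vector set \<Rightarrow> ('a \<Rightarrow> 'a \<Rightarrow> 'a \<Rightarrow> real) \<Rightarrow> bool" where
  "trilinear_form_on V F \<longleftrightarrow>
     (\<forall>u\<in>V. \<forall>v\<in>V. linear_map_on V (\<lambda>w. F u v w) \<and> linear_map_on V (\<lambda>w. F u w v)
                \<and> linear_map_on V (\<lambda>w. F w u v))"

text \<open>A symmetric bilinear form with \<open>k\<close> negative and \<open>l\<close> positive directions; such a form is
  nondegenerate on \<open>V\<close>, and \<open>V\<close> has dimension \<open>k + l\<close>.\<close>

definition has_signature ::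
    "'a::real_vector set \<Rightarrow> ('a \<Rightarrow> 'a \<Rightarrow> real) \<Rightarrow> nat \<Rightarrow> nat \<Rightarrow> bool" where
  "has_signature V b k l \<longleftrightarrow>
     (\<exists>N P. finite N \<and> finite P \<and> card N = k \<and> card P = l \<and> N \<inter> P = {} \<and>
        independent (N \<union> P) \<and> span (N \<union> P) = V \<and>
        (\<forall>u\<in>N. b u u = - 1) \<and> (\<forall>u\<in>P. b u u = 1) \<and>
        (\<forall>u\<in>N \<union> P. \<forall>v\<in>N \<union> P. u \<noteq> v \<longrightarrow> b u v = 0))"


section \<open>Smooth manifolds\<close>

text \<open>\<open>C_k_on k f S\<close> is meant for open sets \<open>S\<close> of a finite-dimensional space.\<close>

primrec C_k_on ::
    "nat \<Rightarrow> ('a::euclidean_space \<Rightarrow> 'b::real_normed_vector) \<Rightarrow> 'a set \<Rightarrow> bool" where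
  "C_k_on 0 f S \<longleftrightarrow> continuous_on S f"
| "C_k_on (Suc k) f S \<longleftrightarrow>
     (\<forall>x\<in>S. f differentiable (at x)) \<and>
     (\<forall>v. C_k_on k (\<lambda>x. frechet_derivative f (at x) v) S)"

definition smooth_on :: "('a::euclidean_space \<Rightarrow> 'b::real_normed_vector) \<Rightarrow> 'a set \<Rightarrow> bool" where
  "smooth_on f S \<longleftrightarrow> (\<forall>k. C_k_on k f S)"

text \<open>The manifold is the whole Hausdorff, second countable type \<open>'m\<close>; its dimension is
  \<open>DIM('e)\<close>. A chart is a pair of its domain and its coordinate map.\<close>

type_synonym ('m, 'e) atlas = "('m set \<times> ('m \<Rightarrow> 'e)) set"

definition smooth_atlas ::
    "('m::{t2_space, second_countable_topology}, 'e::euclidean_space) atlas \<Rightarrow> bool" where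
  "smooth_atlas A \<longleftrightarrow>
     (\<Union>(U, c)\<in>A. U) = UNIV \<and>
     (\<forall>(U, c)\<in>A. open U \<and> open (c ` U) \<and> homeomorphism U (c ` U) c (inv_into U c)) \<and>
     (\<forall>(U, c)\<in>A. \<forall>(V, d)\<in>A. smooth_on (d \<circ> inv_into U c) (c ` (U \<inter> V)))"

definition smooth_functions ::
    "('m::topological_space, 'e::euclidean_space) atlas \<Rightarrow> ('m \<Rightarrow> real) set" where
  "smooth_functions A = {f. \<forall>(U, c)\<in>A. smooth_on (f \<circ> inv_into U c) (c ` U)}"

text \<open>Tangent vectors at \<open>p\<close> are derivations at \<open>p\<close> of the algebra of smooth functions. They are
  set to 0 on non-smooth functions, so that equality of tangent vectors is equality in HOL.\<close>

type_synonym 'm tvec = "('m \<Rightarrow> real) \<Rightarrow> real"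

definition tangent_space ::
    "('m::topological_space, 'e::euclidean_space) atlas \<Rightarrow> 'm \<Rightarrow> 'm tvec set" where
  "tangent_space A p =
     {v. linear_map_on (smooth_functions A) v \<and>
         (\<forall>f\<in>smooth_functions A. \<forall>h\<in>smooth_functions A.
            v (\<lambda>q. f q * h q) = f p * v h + h p * v f) \<and>
         (\<forall>f. f \<notin> smooth_functions A \<longrightarrow> v f = 0)}"

type_synonym 'm vfield = "'m \<Rightarrow> 'm tvec"

definition vector_fields ::
    "('m::topological_space, 'e::euclidean_space) atlas \<Rightarrow> 'm vfield set" where
  "vector_fields A =
     {X. (\<forall>p. X p \<in> tangent_space A p) \<and>
         (\<forall>f\<in>smooth_functions A. (\<lambda>p. X p f) \<in> smooth_functions A)}"

definition fscale :: "('m \<Rightarrow> real) \<Rightarrow> 'm vfield \<Rightarrow> 'm vfield" (infixr "\<cdot>" 75) where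
  "f \<cdot> X = (\<lambda>p. f p *\<^sub>R X p)"

definition Lie_bracket :: "'m vfield \<Rightarrow> 'm vfield \<Rightarrow> 'm vfield" where
  "Lie_bracket X Y = (\<lambda>p f. X p (\<lambda>q. Y q f) - Y p (\<lambda>q. X q f))"


section \<open>Tensor fields\<close>

text \<open>A tensor field is given by its values at points. Smoothness means that smooth vector fields
  are mapped to smooth vector fields or smooth functions.\<close>

type_synonym 'm endo_field = "'m \<Rightarrow> 'm tvec \<Rightarrow> 'm tvec"
type_synonym 'm form_field = "'m \<Rightarrow> 'm tvec \<Rightarrow> real"
type_synonym 'm metric_field = "'m \<Rightarrow> 'm tvec \<Rightarrow> 'm tvec \<Rightarrow> real"

definition ap1 :: "('m \<Rightarrow> 'm tvec \<Rightarrow> 'b) \<Rightarrow> 'm vfield \<Rightarrow> 'm \<Rightarrow> 'b" where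
  "ap1 S X = (\<lambda>p. S p (X p))"

definition ap2 :: "('m \<Rightarrow> 'm tvec \<Rightarrow> 'm tvec \<Rightarrow> 'b) \<Rightarrow> 'm vfield \<Rightarrow> 'm vfield \<Rightarrow> 'm \<Rightarrow> 'b" where
  "ap2 S X Y = (\<lambda>p. S p (X p) (Y p))"

definition endomorphism_field ::
    "('m::topological_space, 'e::euclidean_space) atlas \<Rightarrow> 'm endo_field \<Rightarrow> bool" where
  "endomorphism_field A \<phi> \<longleftrightarrow>
     (\<forall>p. linear_map_on (tangent_space A p) (\<phi> p) \<and> \<phi> p ` tangent_space A p \<subseteq> tangent_space A p) \<and>
     (\<forall>X\<in>vector_fields A. ap1 \<phi> X \<in> vector_fields A)"

definition one_form ::
    "('m::topological_space, 'e::euclidean_space) atlas \<Rightarrow> 'm form_field \<Rightarrow> bool" where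
  "one_form A \<eta> \<longleftrightarrow>
     (\<forall>p. linear_map_on (tangent_space A p) (\<eta> p)) \<and>
     (\<forall>X\<in>vector_fields A. ap1 \<eta> X \<in> smooth_functions A)"

definition pseudo_Riemannian_metric ::
    "('m::topological_space, 'e::euclidean_space) atlas \<Rightarrow> 'm metric_field \<Rightarrow> nat \<Rightarrow> nat \<Rightarrow> bool" where
  "pseudo_Riemannian_metric A g k l \<longleftrightarrow>
     (\<forall>p. bilinear_form_on (tangent_space A p) (g p) \<and>
          (\<forall>u\<in>tangent_space A p. \<forall>v\<in>tangent_space A p. g p u v = g p v u) \<and>
          has_signature (tangent_space A p) (g p) k l) \<and>
     (\<forall>X\<in>vector_fields A. \<forall>Y\<in>vector_fields A. ap2 g X Y \<in> smooth_functions A)"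


section \<open>Connections\<close>

type_synonym 'm connection = "'m vfield \<Rightarrow> 'm vfield \<Rightarrow> 'm vfield"

definition linear_connection ::
    "('m::topological_space, 'e::euclidean_space) atlas \<Rightarrow> 'm connection \<Rightarrow> bool" where
  "linear_connection A D \<longleftrightarrow>
     (\<forall>X\<in>vector_fields A. \<forall>Y\<in>vector_fields A.
        D X Y \<in> vector_fields A \<and>
        (\<forall>Z\<in>vector_fields A. D (X + Z) Y = D X Y + D Z Y \<and> D X (Y + Z) = D X Y + D X Z) \<and>
        (\<forall>f\<in>smooth_functions A.
           D (f \<cdot> X) Y = f \<cdot> D X Y \<and>
           D X (f \<cdot> Y) = (\<lambda>p. X p f) \<cdot> Y + f \<cdot> D X Y))"

definition Levi_Civita ::
    "('m::topological_space, 'e::euclidean_space) atlas \<Rightarrow> 'm metric_field \<Rightarrow> 'm connection \<Rightarrow> bool" where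
  "Levi_Civita A g D \<longleftrightarrow>
     linear_connection A D \<and>
     (\<forall>X\<in>vector_fields A. \<forall>Y\<in>vector_fields A. D X Y - D Y X = Lie_bracket X Y) \<and>
     (\<forall>X\<in>vector_fields A. \<forall>Y\<in>vector_fields A. \<forall>Z\<in>vector_fields A. \<forall>p.
        X p (ap2 g Y Z) = ap2 g (D X Y) Z p + ap2 g Y (D X Z) p)"

definition cov_endo :: "'m connection \<Rightarrow> 'm endo_field \<Rightarrow> 'm vfield \<Rightarrow> 'm vfield \<Rightarrow> 'm vfield" where
  "cov_endo D \<phi> X Y = D X (ap1 \<phi> Y) - ap1 \<phi> (D X Y)"

definition cov_form :: "'m connection \<Rightarrow> 'm form_field \<Rightarrow> 'm vfield \<Rightarrow> 'm vfield \<Rightarrow> 'm \<Rightarrow> real" where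
  "cov_form D \<eta> X Y = (\<lambda>p. X p (ap1 \<eta> Y) - ap1 \<eta> (D X Y) p)"

text \<open>Here \<open>T\<close> is a vector-valued tensor field of two arguments, acting on vector fields. It
  need not be given as the torsion of \<open>D\<close>: if \<open>D = \<nabla> + T/2\<close> with \<open>\<nabla>\<close> torsion-free, then \<open>T\<close> is
  the torsion of \<open>D\<close> as soon as \<open>T\<close> is skew-symmetric.\<close>

definition parallel_torsion ::
    "('m::topological_space, 'e::euclidean_space) atlas \<Rightarrow> 'm connection \<Rightarrow>
     ('m vfield \<Rightarrow> 'm vfield \<Rightarrow> 'm vfield) \<Rightarrow> bool" where
  "parallel_torsion A D T \<longleftrightarrow>
     (\<forall>X\<in>vector_fields A. \<forall>Y\<in>vector_fields A. \<forall>Z\<in>vector_fields A.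
        D X (T Y Z) - T (D X Y) Z - T Y (D X Z) = 0)"

definition curvature :: "'m connection \<Rightarrow> 'm vfield \<Rightarrow> 'm vfield \<Rightarrow> 'm vfield \<Rightarrow> 'm vfield" where
  "curvature D X Y Z = D X (D Y Z) - D Y (D X Z) - D (Lie_bracket X Y) Z"

definition curvature4 ::
    "'m metric_field \<Rightarrow> 'm connection \<Rightarrow>
     'm vfield \<Rightarrow> 'm vfield \<Rightarrow> 'm vfield \<Rightarrow> 'm vfield \<Rightarrow> 'm \<Rightarrow> real" where
  "curvature4 g D X Y Z W = ap2 g (curvature D X Y Z) W"


section \<open>Almost contact B-metric manifolds\<close>

definition almost_contact_B_metric ::
    "nat \<Rightarrow> ('m::{t2_space, second_countable_topology}, 'e::euclidean_space) atlas \<Rightarrow>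
     'm endo_field \<Rightarrow> 'm vfield \<Rightarrow> 'm form_field \<Rightarrow> 'm metric_field \<Rightarrow> bool" where
  "almost_contact_B_metric n A \<phi> \<xi> \<eta> g \<longleftrightarrow>
     DIM('e) = 2 * n + 1 \<and> smooth_atlas A \<and>
     endomorphism_field A \<phi> \<and> \<xi> \<in> vector_fields A \<and> one_form A \<eta> \<and>
     pseudo_Riemannian_metric A g n (n + 1) \<and>
     (\<forall>p. \<phi> p (\<xi> p) = 0 \<and> \<eta> p (\<xi> p) = 1 \<and>
        (\<forall>u\<in>tangent_space A p.
           \<phi> p (\<phi> p u) = - u + \<eta> p u *\<^sub>R \<xi> p \<and> \<eta> p (\<phi> p u) = 0) \<and>
        (\<forall>u\<in>tangent_space A p. \<forall>v\<in>tangent_space A p.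
           g p (\<phi> p u) (\<phi> p v) = - g p u v + \<eta> p u * \<eta> p v))"

definition fundamental_F ::
    "'m metric_field \<Rightarrow> 'm connection \<Rightarrow> 'm endo_field \<Rightarrow>
     'm vfield \<Rightarrow> 'm vfield \<Rightarrow> 'm vfield \<Rightarrow> 'm \<Rightarrow> real" where
  "fundamental_F g D \<phi> X Y Z = ap2 g (cov_endo D \<phi> X Y) Z"

text \<open>The next three conditions are linear-algebraic. They concern a \<open>(0,3)\<close>-tensor \<open>F\<close> on a vector
  space \<open>V\<close> with structure \<open>f\<close>, \<open>e\<close>, \<open>h\<close> (the values of \<open>\<phi>\<close>, \<open>\<xi>\<close>, \<open>\<eta>\<close> at one point).\<close>

definition property_P ::
    "'v::real_vector set \<Rightarrow> ('v \<Rightarrow> 'v) \<Rightarrow> 'v \<Rightarrow> ('v \<Rightarrow> real) \<Rightarrow> ('v \<Rightarrow> 'v \<Rightarrow> 'v \<Rightarrow> real) \<Rightarrow> bool" where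
  "property_P V f e h F \<longleftrightarrow>
     (\<forall>x\<in>V. \<forall>y\<in>V. \<forall>z\<in>V.
        F x y z = F x z y \<and>
        F x y z = F x (f y) (f z) + h y * F x e z + h z * F x y e)"

definition class_F3 ::
    "'v::real_vector set \<Rightarrow> 'v \<Rightarrow> ('v \<Rightarrow> 'v \<Rightarrow> 'v \<Rightarrow> real) \<Rightarrow> bool" where
  "class_F3 V e F \<longleftrightarrow>
     (\<forall>x\<in>V. \<forall>y\<in>V. \<forall>z\<in>V.
        F x y z + F y z x + F z x y = 0 \<and> F e y z = 0 \<and> F x y e = 0)"

definition class_F7 ::
    "'v::real_vector set \<Rightarrow> ('v \<Rightarrow> 'v) \<Rightarrow> ('v \<Rightarrow> 'v \<Rightarrow> 'v \<Rightarrow> real) \<Rightarrow> bool" where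
  "class_F7 V f F \<longleftrightarrow>
     (\<forall>x\<in>V. \<forall>y\<in>V. \<forall>z\<in>V.
        F x y z + F y z x + F z x y = 0 \<and>
        F x y z = - F (f x) (f y) z - F (f x) y (f z))"

definition in_F3_F7 ::
    "('m::topological_space, 'e::euclidean_space) atlas \<Rightarrow> 'm endo_field \<Rightarrow> 'm vfield \<Rightarrow>
     'm form_field \<Rightarrow> 'm metric_field \<Rightarrow> 'm connection \<Rightarrow> bool" where
  "in_F3_F7 A \<phi> \<xi> \<eta> g D \<longleftrightarrow>
     (\<forall>p. \<exists>F' F''.
        trilinear_form_on (tangent_space A p) F' \<and> trilinear_form_on (tangent_space A p) F'' \<and>
        property_P (tangent_space A p) (\<phi> p) (\<xi> p) (\<eta> p) F' \<and>
        property_P (tangent_space A p) (\<phi> p) (\<xi> p) (\<eta> p) F'' \<and>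
        class_F3 (tangent_space A p) (\<xi> p) F' \<and>
        class_F7 (tangent_space A p) (\<phi> p) F'' \<and>
        (\<forall>X\<in>vector_fields A. \<forall>Y\<in>vector_fields A. \<forall>Z\<in>vector_fields A.
           fundamental_F g D \<phi> X Y Z p = F' (X p) (Y p) (Z p) + F'' (X p) (Y p) (Z p)))"

definition phi_Kaehler_type ::
    "('m::topological_space, 'e::euclidean_space) atlas \<Rightarrow> 'm endo_field \<Rightarrow>
     ('m vfield \<Rightarrow> 'm vfield \<Rightarrow> 'm vfield \<Rightarrow> 'm vfield \<Rightarrow> 'm \<Rightarrow> real) \<Rightarrow> bool" where
  "phi_Kaehler_type A \<phi> L \<longleftrightarrow>
     (\<forall>X\<in>vector_fields A. \<forall>Y\<in>vector_fields A. \<forall>Z\<in>vector_fields A. \<forall>W\<in>vector_fields A. \<forall>p.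
        L X Y Z W p = - L Y X Z W p \<and>
        L X Y Z W p = - L X Y W Z p \<and>
        L X Y Z W p + L Y Z X W p + L Z X Y W p = 0 \<and>
        L X Y (ap1 \<phi> Z) (ap1 \<phi> W) p = - L X Y Z W p)"

end

theory Submission
  imports Defs
begin

text \<open>For \<open>F = F' + F''\<close> with \<open>F'\<close> in \<open>\<F>\<^sub>3\<close> and \<open>F''\<close> in \<open>\<F>\<^sub>7\<close> the form \<open>2 g (T(x, y), z)\<close> is the cyclic
  sum of \<open>F'(x, \<phi> y, z) + 4 \<eta>(z) F''(x, \<phi> y, \<xi>)\<close>, where each term is skew in two of its arguments;
  so \<open>T\<close> is totally skew-symmetric, and \<open>T(z, \<xi>) = - 2 \<nabla>\<^sub>z \<xi>\<close>.
  Since \<open>D T = 0\<close>, expanding \<open>D = \<nabla> + T/2\<close> gives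
  \<open>K(x, y, z, w) = R(x, y, z, w) + 1/4 g (T(x, y), T(z, w)) + 1/4 S\<close>, where \<open>S\<close> is the cyclic sum of
  \<open>g (T(x, y), T(z, w))\<close> over \<open>x, y, z\<close>. By the first Bianchi identity for \<open>\<nabla>\<close> the cyclic sum of
  \<open>K\<close> equals \<open>S\<close>, so \<open>S = 0\<close> when \<open>K\<close> is of \<open>\<phi>\<close>-Kaehler type. Both claims are then the identity
  \<open>K(x, y, \<phi> z, \<phi> w) = - K(x, y, z, w)\<close>, the second one with \<open>w = \<xi>\<close>.\<close>

section \<open>Smooth functions\<close>

text \<open>Differentiability and the derivative at a point depend only on the germ there, and the
  open set \<open>S\<close> is a neighbourhood of each of its points. This lets the sum and product
  rules be substituted on \<open>S\<close> alone.\<close>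

lemma C_k_on_cong:
  assumes "open S" "\<And>x. x \<in> S \<Longrightarrow> f x = h x"
  shows "C_k_on k f S \<longleftrightarrow> C_k_on k h S"
  using assms(2)
proof (induction k arbitrary: f h)
  case 0
  then show ?case by (simp cong: continuous_on_cong)
next
  case (Suc k)
  have *: "(f has_derivative d) (at x) \<longleftrightarrow> (h has_derivative d) (at x)" if "x \<in> S" for x d
    using has_derivative_transform_within_open[OF _ \<open>open S\<close> that] Suc.prems by metis
  have d: "f differentiable (at x) \<longleftrightarrow> h differentiable (at x)" if "x \<in> S" for x
    using *[OF that] by (simp add: differentiable_def)
  have "frechet_derivative f (at x) = frechet_derivative h (at x)" if "x \<in> S" for x
    using *[OF that] by (simp add: frechet_derivative_def)
  then have "C_k_on k (\<lambda>x. frechet_derivative f (at x) v) S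
      \<longleftrightarrow> C_k_on k (\<lambda>x. frechet_derivative h (at x) v) S" for v
    by (intro Suc.IH) simp
  with d show ?case by simp
qed

lemma C_k_on_Suc_imp: "C_k_on (Suc k) f S \<Longrightarrow> C_k_on k f S"
proof (induction k arbitrary: f)
  case 0
  then show ?case
    by (auto intro!: continuous_at_imp_continuous_on differentiable_imp_continuous_within)
next
  case (Suc k)
  then show ?case by (subst C_k_on.simps) auto
qed

lemma C_k_on_const: "C_k_on k (\<lambda>x. c) S"
  by (induction k arbitrary: c) auto

lemma C_k_on_add:
  assumes "open S"
  shows "C_k_on k f S \<Longrightarrow> C_k_on k h S \<Longrightarrow> C_k_on k (\<lambda>x. f x + h x) S"
proof (induction k arbitrary: f h)
  case 0
  then show ?case by (simp add: continuous_on_add)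
next
  case (Suc k)
  have "frechet_derivative (\<lambda>x. f x + h x) (at x) v
      = frechet_derivative f (at x) v + frechet_derivative h (at x) v" if "x \<in> S" for x v
  proof -
    have "(f has_derivative frechet_derivative f (at x)) (at x)"
      "(h has_derivative frechet_derivative h (at x)) (at x)"
      using Suc.prems that by (simp_all add: frechet_derivative_works[symmetric])
    from frechet_derivative_at[OF has_derivative_add[OF this], symmetric] show ?thesis
      by simp
  qed
  then have "C_k_on k (\<lambda>x. frechet_derivative (\<lambda>x. f x + h x) (at x) v) S" for v
    using Suc by (subst C_k_on_cong[OF assms]) auto
  with Suc.prems show ?case by simp
qed

lemma C_k_on_mult:
  fixes f h :: "'a::euclidean_space \<Rightarrow> real"
  assumes "open S"
  shows "C_k_on k f S \<Longrightarrow> C_k_on k h S \<Longrightarrow> C_k_on k (\<lambda>x. f x * h x) S"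
proof (induction k arbitrary: f h)
  case 0
  then show ?case by (simp add: continuous_on_mult)
next
  case (Suc k)
  have "frechet_derivative (\<lambda>x. f x * h x) (at x) v
      = f x * frechet_derivative h (at x) v + frechet_derivative f (at x) v * h x"
    if "x \<in> S" for x v
  proof -
    have "(f has_derivative frechet_derivative f (at x)) (at x)"
      "(h has_derivative frechet_derivative h (at x)) (at x)"
      using Suc.prems that by (simp_all add: frechet_derivative_works[symmetric])
    from frechet_derivative_at[OF has_derivative_mult[OF this], symmetric] show ?thesis
      by simp
  qed
  \<comment> \<open>The product rule keeps undifferentiated factors, so the induction hypothesis
    needs \<open>f\<close> and \<open>h\<close> themselves at order \<open>k\<close>;
    \<open>C_k_on_Suc_imp\<close> lowers them.\<close>
  moreover have "C_k_on k (\<lambda>x. f x * frechet_derivative h (at x) v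
      + frechet_derivative f (at x) v * h x) S" for v
    using Suc.prems Suc.prems[THEN C_k_on_Suc_imp]
    by (intro C_k_on_add[OF assms] Suc.IH) simp_all
  ultimately have "C_k_on k (\<lambda>x. frechet_derivative (\<lambda>x. f x * h x) (at x) v) S" for v
    by (subst C_k_on_cong[OF assms]) auto
  with Suc.prems show ?case by simp
qed

lemma smooth_on_const: "smooth_on (\<lambda>x. c) S"
  by (simp add: smooth_on_def C_k_on_const)

lemma smooth_on_add: "open S \<Longrightarrow> smooth_on f S \<Longrightarrow> smooth_on h S \<Longrightarrow> smooth_on (\<lambda>x. f x + h x) S"
  by (simp add: smooth_on_def C_k_on_add)

lemma smooth_on_mult:
  fixes f h :: "'a::euclidean_space \<Rightarrow> real"
  shows "open S \<Longrightarrow> smooth_on f S \<Longrightarrow> smooth_on h S \<Longrightarrow> smooth_on (\<lambda>x. f x * h x) S"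
  by (simp add: smooth_on_def C_k_on_mult)

lemma smooth_functions_const: "(\<lambda>_. c) \<in> smooth_functions A"
  by (auto simp: smooth_functions_def o_def smooth_on_const)

lemma smooth_functions_add:
  assumes "smooth_atlas A" "f \<in> smooth_functions A" "h \<in> smooth_functions A"
  shows "(\<lambda>q. f q + h q) \<in> smooth_functions A"
  using assms unfolding smooth_functions_def smooth_atlas_def
  by (fastforce simp: o_def intro!: smooth_on_add)

lemma smooth_functions_mult:
  assumes "smooth_atlas A" "f \<in> smooth_functions A" "h \<in> smooth_functions A"
  shows "(\<lambda>q. f q * h q) \<in> smooth_functions A"
  using assms unfolding smooth_functions_def smooth_atlas_def
  by (fastforce simp: o_def intro!: smooth_on_mult)

lemma smooth_functions_diff:
  assumes "smooth_atlas A" "f \<in> smooth_functions A" "h \<in> smooth_functions A"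
  shows "(\<lambda>q. f q - h q) \<in> smooth_functions A"
  using smooth_functions_add[OF assms(1,2) smooth_functions_mult[OF assms(1)
        smooth_functions_const[of "- 1"] assms(3)]] by simp

section \<open>Vector fields\<close>

lemma tangent_space_add:
  "u \<in> tangent_space A p \<Longrightarrow> v \<in> tangent_space A p \<Longrightarrow> u + v \<in> tangent_space A p"
  by (auto simp: tangent_space_def linear_map_on_def algebra_simps)

lemma tangent_space_scaleR: "u \<in> tangent_space A p \<Longrightarrow> c *\<^sub>R u \<in> tangent_space A p"
  by (auto simp: tangent_space_def linear_map_on_def scaleR_fun_def algebra_simps)

lemma vector_fields_in: "X \<in> vector_fields A \<Longrightarrow> X p \<in> tangent_space A p"
  by (simp add: vector_fields_def)

lemma vector_fields_apply:
  "X \<in> vector_fields A \<Longrightarrow> f \<in> smooth_functions A \<Longrightarrow> (\<lambda>p. X p f) \<in> smooth_functions A"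
  by (simp add: vector_fields_def)

lemma vector_fields_nonsmooth: "X \<in> vector_fields A \<Longrightarrow> f \<notin> smooth_functions A \<Longrightarrow> X p f = 0"
  by (simp add: vector_fields_def tangent_space_def)

lemma vector_fields_apply_diff:
  assumes "smooth_atlas A" "X \<in> vector_fields A" "f \<in> smooth_functions A" "h \<in> smooth_functions A"
  shows "X p (\<lambda>q. f q - h q) = X p f - X p h"
proof -
  have l: "linear_map_on (smooth_functions A) (X p)"
    using assms by (simp add: vector_fields_def tangent_space_def)
  have "X p ((\<lambda>q. f q - h q) + h) = X p (\<lambda>q. f q - h q) + X p h"
    using l smooth_functions_diff[OF assms(1,3,4)] assms(4) by (simp add: linear_map_on_def)
  moreover have "(\<lambda>q. f q - h q) + h = f" by (simp add: fun_eq_iff)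
  ultimately show ?thesis by simp
qed

lemma vector_fields_apply_mult:
  assumes "X \<in> vector_fields A" "f \<in> smooth_functions A" "h \<in> smooth_functions A"
  shows "X p (\<lambda>q. f q * h q) = f p * X p h + h p * X p f"
  using assms by (simp add: vector_fields_def tangent_space_def)

lemma vector_fields_apply_const:
  assumes "X \<in> vector_fields A" shows "X p (\<lambda>_. c) = 0"
proof -
  have l: "linear_map_on (smooth_functions A) (X p)"
    using assms by (simp add: vector_fields_def tangent_space_def)
  have "X p (c *\<^sub>R (\<lambda>_. 1)) = c *\<^sub>R X p (\<lambda>_. 1)"
    using l smooth_functions_const unfolding linear_map_on_def by blast
  \<comment> \<open>The Leibniz rule for 1 = 1 * 1 makes this value equal to twice itself.\<close>
  moreover have "X p (\<lambda>_. 1) = 0"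
    using vector_fields_apply_mult[OF assms smooth_functions_const smooth_functions_const, of p 1 1]
    by simp
  ultimately show ?thesis by (simp add: scaleR_fun_def)
qed

lemma vector_fields_add:
  assumes "smooth_atlas A" "X \<in> vector_fields A" "Y \<in> vector_fields A"
  shows "X + Y \<in> vector_fields A"
  using assms by (simp add: vector_fields_def tangent_space_add smooth_functions_add)

lemma vector_fields_fscale:
  assumes "smooth_atlas A" "f \<in> smooth_functions A" "X \<in> vector_fields A"
  shows "f \<cdot> X \<in> vector_fields A"
proof -
  have "(f \<cdot> X) p \<in> tangent_space A p" for p
    using assms by (simp add: fscale_def tangent_space_scaleR vector_fields_in)
  moreover have "(\<lambda>p. (f \<cdot> X) p h) \<in> smooth_functions A" if "h \<in> smooth_functions A" for h
    using assms that by (simp add: fscale_def scaleR_fun_def smooth_functions_mult vector_fields_apply)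
  ultimately show ?thesis by (simp add: vector_fields_def)
qed

lemma vector_fields_scaleR:
  assumes "smooth_atlas A" "X \<in> vector_fields A"
  shows "c *\<^sub>R X \<in> vector_fields A"
  using vector_fields_fscale[OF assms(1) smooth_functions_const[of c] assms(2)]
  by (simp add: fscale_def scaleR_fun_def[where 'a='a])

lemma vector_fields_uminus:
  assumes "smooth_atlas A" "X \<in> vector_fields A"
  shows "- X \<in> vector_fields A"
  using vector_fields_scaleR[OF assms, of "- 1"] by simp

lemma vector_fields_diff:
  assumes "smooth_atlas A" "X \<in> vector_fields A" "Y \<in> vector_fields A"
  shows "X - Y \<in> vector_fields A"
  using vector_fields_add[OF assms(1,2) vector_fields_uminus[OF assms(1,3)]] by simp

section \<open>The Jacobi identity for vector fields\<close>

lemma Lie_bracket_Lie_bracket: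
  assumes "smooth_atlas A" "X \<in> vector_fields A" "Y \<in> vector_fields A" "Z \<in> vector_fields A"
    and "f \<in> smooth_functions A"
  shows "Lie_bracket X (Lie_bracket Y Z) p f
    = X p (\<lambda>q. Y q (\<lambda>r. Z r f)) - X p (\<lambda>q. Z q (\<lambda>r. Y r f))
      - (Y p (\<lambda>q. Z q (\<lambda>r. X r f)) - Z p (\<lambda>q. Y q (\<lambda>r. X r f)))"
  unfolding Lie_bracket_def
  by (subst vector_fields_apply_diff[OF assms(1,2)]) (simp_all add: assms vector_fields_apply)

lemma Lie_bracket_Jacobi:
  assumes "smooth_atlas A" "X \<in> vector_fields A" "Y \<in> vector_fields A" "Z \<in> vector_fields A"
  shows "Lie_bracket X (Lie_bracket Y Z) + Lie_bracket Y (Lie_bracket Z X)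
    + Lie_bracket Z (Lie_bracket X Y) = 0"
proof (intro ext)
  fix p f
  show "(Lie_bracket X (Lie_bracket Y Z) + Lie_bracket Y (Lie_bracket Z X)
    + Lie_bracket Z (Lie_bracket X Y)) p f = 0 p f"
  proof (cases "f \<in> smooth_functions A")
    case True
    then show ?thesis using assms by (simp add: Lie_bracket_Lie_bracket)
  next
    \<comment> \<open>By convention all fields give 0 on a non-smooth \<open>f\<close>, so every
      inner argument becomes the constant 0, which a derivation kills.\<close>
    case False
    then show ?thesis using assms
      by (simp add: Lie_bracket_def vector_fields_nonsmooth vector_fields_apply_const)
  qed
qed

section \<open>The classes \<open>\<F>\<^sub>3\<close> and \<open>\<F>\<^sub>7\<close> at a point\<close>

text \<open>This is g(T(x, y), z) at one point in terms of F: both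
  \<open>g (\<nabla>\<^sub>y \<xi>, z)\<close> and \<open>(\<nabla>\<^sub>y \<eta>) z\<close> become
  F(y, \<phi> z, \<xi>). Being linear in F, it can be studied for F' and F'' separately.\<close>

definition torsion_form ::
  "('v \<Rightarrow> 'v) \<Rightarrow> 'v \<Rightarrow> ('v \<Rightarrow> real) \<Rightarrow> ('v \<Rightarrow> 'v \<Rightarrow> 'v \<Rightarrow> real) \<Rightarrow> 'v \<Rightarrow> 'v \<Rightarrow> 'v \<Rightarrow> real" where
  "torsion_form f e h F x y z = 1/2 * (2 * F x (f y) z - F y (f x) z + F (f y) x z
     + 3 * (h x * F y (f z) e) - 4 * (h y * F x (f z) e) + 2 * (h z * F x (f y) e))"

text \<open>Two adjacent transpositions generate all permutations of the three slots, so this is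
  total skew-symmetry.\<close>

definition skew_form_on :: "'v set \<Rightarrow> ('v \<Rightarrow> 'v \<Rightarrow> 'v \<Rightarrow> real) \<Rightarrow> bool" where
  "skew_form_on V t \<longleftrightarrow> (\<forall>x\<in>V. \<forall>y\<in>V. \<forall>z\<in>V. t x y z = - t y x z \<and> t x y z = - t x z y)"

text \<open>This models one tangent space with the values of \<phi>, \<xi>, \<eta>. Property (P) and
  both class conditions are metric-free, so the classes can be treated here by linear
  algebra.\<close>

locale contact_space =
  fixes V :: "'v::real_vector set" and f e h
  assumes subspace: "\<And>u v. u \<in> V \<Longrightarrow> v \<in> V \<Longrightarrow> u + v \<in> V" "\<And>c u. u \<in> V \<Longrightarrow> c *\<^sub>R u \<in> V"
    and f_in: "\<And>u. u \<in> V \<Longrightarrow> f u \<in> V" and e_in: "e \<in> V"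
    and f_e: "f e = 0" and h_e: "h e = (1::real)"
    and f_f: "\<And>u. u \<in> V \<Longrightarrow> f (f u) = - u + h u *\<^sub>R e" and h_f: "\<And>u. u \<in> V \<Longrightarrow> h (f u) = 0"
begin

lemma zero_in: "0 \<in> V"
  using subspace(2)[OF e_in, of 0] by simp

lemma trilinear_zero:
  assumes "trilinear_form_on V F" "u \<in> V" "v \<in> V"
  shows "F 0 u v = 0" "F u 0 v = 0" "F u v 0 = 0"
proof -
  have z: "l 0 = 0" if "linear_map_on V l" for l :: "'v \<Rightarrow> real"
    using that e_in unfolding linear_map_on_def by (metis scale_zero_left)
  show "F 0 u v = 0" "F u 0 v = 0" "F u v 0 = 0"
    using assms z unfolding trilinear_form_on_def by blast+
qed

lemma trilinear_ff:
  assumes F: "trilinear_form_on V F" and V: "x \<in> V" "u \<in> V" "v \<in> V"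
  shows "F (f (f x)) u v = - F x u v + h x * F e u v"
    and "F u (f (f x)) v = - F u x v + h x * F u e v"
    and "F u v (f (f x)) = - F u v x + h x * F u v e"
proof -
  have l: "l (f (f x)) = - l x + h x * l e" if l: "linear_map_on V l" for l :: "'v \<Rightarrow> real"
  proof -
    have "l (- 1 *\<^sub>R x + h x *\<^sub>R e) = - 1 *\<^sub>R l x + h x *\<^sub>R l e"
      using l V e_in subspace unfolding linear_map_on_def by metis
    then show ?thesis using f_f V by simp
  qed
  have L: "linear_map_on V (\<lambda>w. F w u v)" "linear_map_on V (\<lambda>w. F u w v)" "linear_map_on V (F u v)"
    using F V unfolding trilinear_form_on_def by auto
  show "F (f (f x)) u v = - F x u v + h x * F e u v"
    "F u (f (f x)) v = - F u x v + h x * F u e v"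
    "F u v (f (f x)) = - F u v x + h x * F u v e"
    using L[THEN l] by simp_all
qed

text \<open>Property (P) is applied with \<open>f y\<close> for \<open>y\<close>:
  \<open>h (f y) = 0\<close> removes one term, and \<open>f (f y) = - y + h y *\<^sub>R e\<close>
  produces the sign and the extra term in \<open>e\<close>.\<close>

lemma property_P_f:
  assumes "trilinear_form_on V F" "property_P V f e h F" "x \<in> V" "y \<in> V" "z \<in> V"
  shows "F x (f y) z = - F x y (f z) + h y * F x e (f z) + h z * F x (f y) e"
proof -
  have "F x (f y) z = F x (f (f y)) (f z) + h (f y) * F x e z + h z * F x (f y) e"
    using assms f_in unfolding property_P_def by blast
  then show ?thesis using assms f_in h_f by (simp add: trilinear_ff)
qed

text \<open>All values with \<open>e\<close> in a slot vanish, so by (P) the expression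
  \<open>F x (f y) z\<close> is skew in \<open>y\<close> and \<open>z\<close>. Its cyclic sum is
  then totally skew.\<close>

lemma F3_skew:
  assumes F: "trilinear_form_on V F" and P: "property_P V f e h F" and c: "class_F3 V e F"
  shows "skew_form_on V (torsion_form f e h F)"
proof -
  have sym: "F x y z = F x z y" if "x \<in> V" "y \<in> V" "z \<in> V" for x y z
    using P that unfolding property_P_def by blast
  have ve: "F x y e = 0" "F x e y = 0" if "x \<in> V" "y \<in> V" for x y
    using c that e_in sym[of x e y] unfolding class_F3_def by auto
  have cyc: "F x y z + F y z x + F z x y = 0" if "x \<in> V" "y \<in> V" "z \<in> V" for x y z
    using c that unfolding class_F3_def by blast
  have ff: "F x (f y) z = - F x (f z) y" if "x \<in> V" "y \<in> V" "z \<in> V" for x y z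
    using property_P_f[OF F P that] that ve sym f_in by simp
  \<comment> \<open>The cyclic identity turns \<open>F (f y) x z\<close> into
    \<open>- F x z (f y) - F z (f y) x\<close>; the first summand halves the leading term, the
    second becomes \<open>F z (f x) y\<close>.\<close>
  have eq: "torsion_form f e h F x y z = 1/2 * (F x (f y) z + F y (f z) x + F z (f x) y)"
    if "x \<in> V" "y \<in> V" "z \<in> V" for x y z
    unfolding torsion_form_def
    using cyc[of "f y" x z] ff[of y x z] ff[of z x y] sym[of z x "f y"] sym[of x z "f y"] that f_in
    by (simp add: ve)
  show ?thesis unfolding skew_form_on_def
  proof (intro ballI)
    fix x y z assume V: "x \<in> V" "y \<in> V" "z \<in> V"
    show "torsion_form f e h F x y z = - torsion_form f e h F y x z
       \<and> torsion_form f e h F x y z = - torsion_form f e h F x z y"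
      using V ff[of x y z] ff[of y z x] ff[of z x y] by (simp add: eq field_simps)
  qed
qed

text \<open>Both sides are 0 in this class. The form is the one of \<open>F7_e\<close>, so that the
  two can be added.\<close>

lemma F3_e:
  assumes F: "trilinear_form_on V F" and P: "property_P V f e h F" and c: "class_F3 V e F"
    and V: "x \<in> V" "z \<in> V"
  shows "torsion_form f e h F x e z = - 2 * F x (f z) e"
proof -
  have "F u v e = 0" "F e u v = 0" if "u \<in> V" "v \<in> V" for u v
    using c that e_in unfolding class_F3_def by auto
  then show ?thesis
    using V f_in e_in zero_in by (simp add: torsion_form_def f_e h_e trilinear_zero[OF F])
qed

text \<open>The tensor is recovered from the 2-form \<open>F x y e\<close>. The first three facts
  come from putting \<open>e\<close> into the first slot of the class condition, the last slot of
  the cyclic identity and the last slot of the class condition.\<close>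

lemma F7_form:
  assumes F: "trilinear_form_on V F" and P: "property_P V f e h F" and c: "class_F7 V f F"
  shows "\<And>y z. y \<in> V \<Longrightarrow> z \<in> V \<Longrightarrow> F e y z = 0"
    and "\<And>x y. x \<in> V \<Longrightarrow> y \<in> V \<Longrightarrow> F x y e = - F y x e"
    and "\<And>x y. x \<in> V \<Longrightarrow> y \<in> V \<Longrightarrow> F (f x) y e = F x (f y) e"
    and "\<And>x y z. x \<in> V \<Longrightarrow> y \<in> V \<Longrightarrow> z \<in> V \<Longrightarrow> F x y z = h y * F x z e + h z * F x y e"
proof -
  have sym: "F x y z = F x z y" if "x \<in> V" "y \<in> V" "z \<in> V" for x y z
    using P that unfolding property_P_def by blast
  have cyc: "F x y z + F y z x + F z x y = 0" if "x \<in> V" "y \<in> V" "z \<in> V" for x y z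
    using c that unfolding class_F7_def by blast
  have c7: "F x y z = - F (f x) (f y) z - F (f x) y (f z)" if "x \<in> V" "y \<in> V" "z \<in> V" for x y z
    using c that unfolding class_F7_def by blast
  show e1: "F e y z = 0" if "y \<in> V" "z \<in> V" for y z
    using c7[OF e_in that] that f_in by (simp add: f_e trilinear_zero[OF F])
  show skew: "F x y e = - F y x e" if "x \<in> V" "y \<in> V" for x y
    using cyc[OF that e_in] e1[OF that] sym[OF that(2) e_in that(1)] by simp
  have ee: "F x e e = 0" if "x \<in> V" for x
    using skew[OF that e_in] e1[OF that e_in] by simp
  have m: "F (f x) (f y) e = - F x y e" if "x \<in> V" "y \<in> V" for x y
    using c7[OF that e_in] that f_in by (simp add: f_e trilinear_zero[OF F])
  show fe: "F (f x) y e = F x (f y) e" if "x \<in> V" "y \<in> V" for x y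
    using m[OF that(1) f_in[OF that(2)]] that f_in ee by (simp add: trilinear_ff[OF F] e_in)
  \<comment> \<open>The class condition at \<open>f x\<close> contains \<open>f (f x)\<close>, which
    acts as \<open>- x\<close> because \<open>F e\<close> vanishes. By \<open>property_P_f\<close>
    the sum \<open>F x (f y) z + F x y (f z)\<close> reduces to its parts with
    \<open>e\<close>.\<close>
  have f1: "F (f x) y z = h y * F x (f z) e + h z * F x (f y) e"
    if "x \<in> V" "y \<in> V" "z \<in> V" for x y z
    using c7[OF f_in[OF that(1)] that(2,3)] property_P_f[OF F P that] that f_in
    by (simp add: trilinear_ff[OF F] e1 sym[of x e "f z"] e_in)
  \<comment> \<open>Inserting \<open>f1\<close> into both terms of \<open>c7\<close> leaves values
    with \<open>e\<close> in a slot; \<open>h (f y) = 0\<close> and \<open>F x e e = 0\<close>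
    remove the surplus.\<close>
  show "F x y z = h y * F x z e + h z * F x y e" if "x \<in> V" "y \<in> V" "z \<in> V" for x y z
    using c7[OF that] f1[of x "f y" z] f1[of x y "f z"] that f_in
    by (simp add: trilinear_ff[OF F] e_in ee h_f)
qed

text \<open>By \<open>a\<close> the bilinear form \<open>F x (f y) e\<close> is skew, and the
  torsion form is twice the cyclic sum of its product with \<open>h\<close>, a wedge product of a
  1-form and a 2-form.\<close>

lemma F7_skew:
  assumes F: "trilinear_form_on V F" and P: "property_P V f e h F" and c: "class_F7 V f F"
  shows "skew_form_on V (torsion_form f e h F)"
proof -
  note q = F7_form[OF F P c]
  have a: "F x (f y) e = - F y (f x) e" if "x \<in> V" "y \<in> V" for x y
    using q(2)[of "f x" y] q(3)[OF that] that f_in by simp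
  have eq: "torsion_form f e h F x y z =
      2 * (h x * F y (f z) e + h y * F z (f x) e + h z * F x (f y) e)"
    if "x \<in> V" "y \<in> V" "z \<in> V" for x y z
    unfolding torsion_form_def
    using q(4)[of x "f y" z] q(4)[of y "f x" z] q(4)[of "f y" x z] a[of x y] a[of x z] that f_in
    by (simp add: h_f q(3) algebra_simps)
  show ?thesis unfolding skew_form_on_def
  proof (intro ballI)
    fix x y z assume V: "x \<in> V" "y \<in> V" "z \<in> V"
    show "torsion_form f e h F x y z = - torsion_form f e h F y x z
       \<and> torsion_form f e h F x y z = - torsion_form f e h F x z y"
      using V a[of x y] a[of y z] a[of x z] by (simp add: eq algebra_simps)
  qed
qed

lemma F7_e:
  assumes F: "trilinear_form_on V F" and P: "property_P V f e h F" and c: "class_F7 V f F"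
    and V: "x \<in> V" "z \<in> V"
  shows "torsion_form f e h F x e z = - 2 * F x (f z) e"
  using V f_in e_in zero_in F7_form(1)[OF F P c]
  by (simp add: torsion_form_def f_e h_e trilinear_zero[OF F])

end

lemma torsion_form_add:
  "torsion_form f e h (\<lambda>x y z. F x y z + G x y z) x y z
    = torsion_form f e h F x y z + torsion_form f e h G x y z"
  by (simp add: torsion_form_def algebra_simps add_divide_distrib)

lemma skew_form_on_add:
  "skew_form_on V s \<Longrightarrow> skew_form_on V t \<Longrightarrow> skew_form_on V (\<lambda>x y z. s x y z + t x y z)"
  unfolding skew_form_on_def by (metis add_uminus_conv_diff minus_add_distrib)

section \<open>Metric connections with parallel skew torsion\<close>

locale metric_manifold =
  fixes A :: "('m::{t2_space, second_countable_topology}, 'e::euclidean_space) atlas"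
    and g :: "'m metric_field" and nabla :: "'m connection" and k l :: nat
  assumes atlas: "smooth_atlas A" and metric: "pseudo_Riemannian_metric A g k l"
    and LC: "Levi_Civita A g nabla"
begin

abbreviation vf where "vf \<equiv> vector_fields A"

lemmas add_in = vector_fields_add[OF atlas]
  and diff_in = vector_fields_diff[OF atlas]
  and uminus_in = vector_fields_uminus[OF atlas]
  and scaleR_in = vector_fields_scaleR[OF atlas]
  and fscale_in = vector_fields_fscale[OF atlas]

lemma g_sym: "X \<in> vf \<Longrightarrow> Y \<in> vf \<Longrightarrow> ap2 g X Y p = ap2 g Y X p"
  using metric by (simp add: pseudo_Riemannian_metric_def ap2_def vector_fields_in)

lemma g_linear: "Y \<in> vf \<Longrightarrow> linear_map_on (tangent_space A p) (\<lambda>u. g p u (Y p))"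
  using metric by (simp add: pseudo_Riemannian_metric_def bilinear_form_on_def vector_fields_in)

lemma g_add_left:
  "X \<in> vf \<Longrightarrow> Y \<in> vf \<Longrightarrow> Z \<in> vf \<Longrightarrow> ap2 g (X + Y) Z p = ap2 g X Z p + ap2 g Y Z p"
  using g_linear by (simp add: linear_map_on_def ap2_def vector_fields_in)

lemma g_scaleR_left: "X \<in> vf \<Longrightarrow> Z \<in> vf \<Longrightarrow> ap2 g (c *\<^sub>R X) Z p = c * ap2 g X Z p"
  using g_linear
  by (simp add: linear_map_on_def ap2_def vector_fields_in scaleR_fun_def[where 'a='m])

lemma g_fscale_left: "X \<in> vf \<Longrightarrow> Z \<in> vf \<Longrightarrow> ap2 g (f \<cdot> X) Z p = f p * ap2 g X Z p"
  using g_linear by (simp add: linear_map_on_def ap2_def vector_fields_in fscale_def)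

lemma g_uminus_left: "X \<in> vf \<Longrightarrow> Z \<in> vf \<Longrightarrow> ap2 g (- X) Z p = - ap2 g X Z p"
  using g_scaleR_left[of X Z "- 1"] by simp

lemma g_diff_left:
  "X \<in> vf \<Longrightarrow> Y \<in> vf \<Longrightarrow> Z \<in> vf \<Longrightarrow> ap2 g (X - Y) Z p = ap2 g X Z p - ap2 g Y Z p"
  using g_add_left[of X "- Y" Z] by (simp add: g_uminus_left uminus_in)

lemma g_add_right:
  "X \<in> vf \<Longrightarrow> Y \<in> vf \<Longrightarrow> Z \<in> vf \<Longrightarrow> ap2 g Z (X + Y) p = ap2 g Z X p + ap2 g Z Y p"
  by (simp add: g_sym[of Z] g_add_left add_in)

lemma g_scaleR_right: "X \<in> vf \<Longrightarrow> Z \<in> vf \<Longrightarrow> ap2 g Z (c *\<^sub>R X) p = c * ap2 g Z X p"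
  by (simp add: g_sym[of Z] g_scaleR_left scaleR_in)

lemma nabla_in: "X \<in> vf \<Longrightarrow> Y \<in> vf \<Longrightarrow> nabla X Y \<in> vf"
  using LC by (simp add: Levi_Civita_def linear_connection_def)

lemma nabla_add: "X \<in> vf \<Longrightarrow> Y \<in> vf \<Longrightarrow> Z \<in> vf \<Longrightarrow> nabla X (Y + Z) = nabla X Y + nabla X Z"
  using LC by (simp add: Levi_Civita_def linear_connection_def)

lemma nabla_fscale:
  "X \<in> vf \<Longrightarrow> Y \<in> vf \<Longrightarrow> f \<in> smooth_functions A \<Longrightarrow>
    nabla X (f \<cdot> Y) = (\<lambda>p. X p f) \<cdot> Y + f \<cdot> nabla X Y"
  using LC by (simp add: Levi_Civita_def linear_connection_def)

lemma nabla_scaleR: "X \<in> vf \<Longrightarrow> Y \<in> vf \<Longrightarrow> nabla X (c *\<^sub>R Y) = c *\<^sub>R nabla X Y"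
  using nabla_fscale[of X Y "\<lambda>_. c"]
  by (simp add: smooth_functions_const vector_fields_apply_const fscale_def
      scaleR_fun_def[where 'a='m] plus_fun_def[where 'a='m])

lemma nabla_uminus: "X \<in> vf \<Longrightarrow> Y \<in> vf \<Longrightarrow> nabla X (- Y) = - nabla X Y"
  using nabla_scaleR[of X Y "- 1"] by simp

lemma nabla_diff: "X \<in> vf \<Longrightarrow> Y \<in> vf \<Longrightarrow> Z \<in> vf \<Longrightarrow> nabla X (Y - Z) = nabla X Y - nabla X Z"
  using nabla_add[of X Y "- Z"] by (simp add: nabla_uminus uminus_in)

lemma torsion_free: "X \<in> vf \<Longrightarrow> Y \<in> vf \<Longrightarrow> Lie_bracket X Y = nabla X Y - nabla Y X"
  using LC by (simp add: Levi_Civita_def)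

lemma metric_compatible:
  "X \<in> vf \<Longrightarrow> Y \<in> vf \<Longrightarrow> Z \<in> vf \<Longrightarrow>
    X p (ap2 g Y Z) = ap2 g (nabla X Y) Z p + ap2 g Y (nabla X Z) p"
  using LC unfolding Levi_Civita_def by blast

text \<open>Torsion-freeness writes the bracket as a difference of two fields, which avoids checking
  the Leibniz rule for commutators.\<close>

lemma Lie_bracket_in: "X \<in> vf \<Longrightarrow> Y \<in> vf \<Longrightarrow> Lie_bracket X Y \<in> vf"
  by (simp add: torsion_free diff_in nabla_in)

lemma curvature_in: "X \<in> vf \<Longrightarrow> Y \<in> vf \<Longrightarrow> Z \<in> vf \<Longrightarrow> curvature nabla X Y Z \<in> vf"
  by (simp add: curvature_def diff_in nabla_in Lie_bracket_in)

lemma first_Bianchi: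
  assumes V: "X \<in> vf" "Y \<in> vf" "Z \<in> vf"
  shows "curvature nabla X Y Z + curvature nabla Y Z X + curvature nabla Z X Y = 0"
proof -
  \<comment> \<open>The bracket inside the last term stays unexpanded, since it is the bracket term
    of \<open>curvature\<close>.\<close>
  have b: "Lie_bracket U (Lie_bracket V W) = nabla U (nabla V W) - nabla U (nabla W V)
      - nabla (Lie_bracket V W) U" if "U \<in> vf" "V \<in> vf" "W \<in> vf" for U V W
    using that
    by (simp add: torsion_free[of U "Lie_bracket V W"] Lie_bracket_in)
      (simp add: torsion_free[of V W] nabla_diff nabla_in)
  from Lie_bracket_Jacobi[OF atlas V] show ?thesis
    using V by (simp add: b curvature_def algebra_simps)
qed

lemma curvature4_Bianchi:
  assumes V: "X \<in> vf" "Y \<in> vf" "Z \<in> vf" "W \<in> vf"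
  shows "curvature4 g nabla X Y Z W p + curvature4 g nabla Y Z X W p
    + curvature4 g nabla Z X Y W p = 0"
proof -
  have "ap2 g (curvature nabla X Y Z + curvature nabla Y Z X + curvature nabla Z X Y) W p = 0"
    using first_Bianchi[OF V(1-3)] g_scaleR_left[OF V(1,4), of 0] by simp
  then show ?thesis using V by (simp add: curvature4_def g_add_left add_in curvature_in)
qed

end

text \<open>The comparison of the two curvatures takes place here without the contact structure.
  Skewness is stated after pairing with \<open>g\<close>, so additivity of \<open>T\<close> in an
  argument is obtained by moving that argument into a slot of \<open>g\<close>.\<close>

locale skew_torsion = metric_manifold A g nabla k l
  for A :: "('m::{t2_space, second_countable_topology}, 'e::euclidean_space) atlas"
    and g nabla k l +
  fixes D :: "'m connection" and T :: "'m vfield \<Rightarrow> 'm vfield \<Rightarrow> 'm vfield"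
  assumes T_in: "\<And>X Y. X \<in> vf \<Longrightarrow> Y \<in> vf \<Longrightarrow> T X Y \<in> vf"
    and T_skew12: "\<And>X Y Z p. X \<in> vf \<Longrightarrow> Y \<in> vf \<Longrightarrow> Z \<in> vf \<Longrightarrow>
      ap2 g (T X Y) Z p = - ap2 g (T Y X) Z p"
    and T_skew23: "\<And>X Y Z p. X \<in> vf \<Longrightarrow> Y \<in> vf \<Longrightarrow> Z \<in> vf \<Longrightarrow>
      ap2 g (T X Y) Z p = - ap2 g (T X Z) Y p"
    and D_eq: "\<And>X Y. X \<in> vf \<Longrightarrow> Y \<in> vf \<Longrightarrow> D X Y = nabla X Y + (1/2) *\<^sub>R T X Y"
    and parallel: "parallel_torsion A D T"
begin

lemma D_in: "X \<in> vf \<Longrightarrow> Y \<in> vf \<Longrightarrow> D X Y \<in> vf"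
  by (simp add: D_eq add_in scaleR_in nabla_in T_in)

lemma T_cyclic:
  "X \<in> vf \<Longrightarrow> Y \<in> vf \<Longrightarrow> Z \<in> vf \<Longrightarrow> ap2 g (T X Y) Z p = ap2 g (T Y Z) X p"
  using T_skew12[of X Y Z p] T_skew23[of Y X Z p] by simp

lemma D_T: "X \<in> vf \<Longrightarrow> Y \<in> vf \<Longrightarrow> Z \<in> vf \<Longrightarrow> D X (T Y Z) = T (D X Y) Z + T Y (D X Z)"
  using parallel unfolding parallel_torsion_def by (simp add: diff_diff_eq)

lemma g_D: "X \<in> vf \<Longrightarrow> Y \<in> vf \<Longrightarrow> W \<in> vf \<Longrightarrow>
    ap2 g (D X Y) W p = ap2 g (nabla X Y) W p + 1/2 * ap2 g (T X Y) W p"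
  by (simp add: D_eq g_add_left g_scaleR_left add_in scaleR_in nabla_in T_in)

text \<open>Cyclicity moves \<open>D U X\<close> out of \<open>T\<close> into a slot of
  \<open>g\<close>, where \<open>D\<close> splits as \<nabla> plus half of \<open>T\<close>.\<close>

lemma g_T_D_first:
  assumes "U \<in> vf" "X \<in> vf" "Y \<in> vf" "W \<in> vf"
  shows "ap2 g (T (D U X) Y) W p
    = ap2 g (nabla U X) (T Y W) p + 1/2 * ap2 g (T U X) (T Y W) p"
  using assms T_cyclic[of "D U X" Y W p]
  by (simp add: g_sym[of "T Y W"] g_D D_in T_in)

text \<open>The same device; the \<nabla> part is moved back into \<open>T\<close>, to match its
  mirror image in \<open>g_D_D\<close>.\<close>

lemma g_T_D_second:
  assumes "U \<in> vf" "X \<in> vf" "Y \<in> vf" "W \<in> vf"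
  shows "ap2 g (T X (D U Y)) W p
    = ap2 g (T X (nabla U Y)) W p + 1/2 * ap2 g (T U Y) (T W X) p"
proof -
  have "ap2 g (T X (D U Y)) W p = ap2 g (D U Y) (T W X) p"
    using assms T_cyclic[of W X "D U Y" p] T_cyclic[of X "D U Y" W p]
    by (simp add: g_sym[of "D U Y"] D_in T_in)
  moreover have "ap2 g (T X (nabla U Y)) W p = ap2 g (nabla U Y) (T W X) p"
    using assms T_cyclic[of W X "nabla U Y" p] T_cyclic[of X "nabla U Y" W p]
    by (simp add: g_sym[of "nabla U Y"] nabla_in T_in)
  ultimately show ?thesis using assms by (simp add: g_D T_in)
qed

text \<open>The right side is sorted for skew-symmetrization: the bracketed pair is symmetric in
  \<open>X\<close> and \<open>Y\<close> and will cancel, and the term with \<open>nabla X Y\<close>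
  will meet the Lie bracket term.\<close>

lemma g_D_D:
  assumes V: "X \<in> vf" "Y \<in> vf" "Z \<in> vf" "W \<in> vf"
  shows "ap2 g (D X (D Y Z)) W p = ap2 g (nabla X (nabla Y Z)) W p
    + 1/2 * (ap2 g (T X (nabla Y Z)) W p + ap2 g (T Y (nabla X Z)) W p)
    + 1/2 * ap2 g (nabla X Y) (T Z W) p + 1/4 * ap2 g (T X Y) (T Z W) p
    + 1/4 * ap2 g (T X Z) (T W Y) p"
proof -
  have "D X (D Y Z) = nabla X (nabla Y Z) + (1/2) *\<^sub>R nabla X (T Y Z) + (1/2) *\<^sub>R T X (D Y Z)"
    using V by (simp add: D_eq[of X] D_eq[of Y Z] D_in add_in scaleR_in nabla_in T_in
        nabla_add nabla_scaleR)
  then have "ap2 g (D X (D Y Z)) W p = ap2 g (nabla X (nabla Y Z)) W p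
      + 1/2 * ap2 g (nabla X (T Y Z)) W p + 1/2 * ap2 g (T X (D Y Z)) W p"
    using V by (simp add: g_add_left g_scaleR_left add_in scaleR_in nabla_in T_in D_in)
  \<comment> \<open>Here \<open>D T = 0\<close> enters: it eliminates the derivative of
    \<open>T\<close>.\<close>
  moreover have "ap2 g (nabla X (T Y Z)) W p
      = ap2 g (T (D X Y) Z) W p + ap2 g (T Y (D X Z)) W p - 1/2 * ap2 g (T X (T Y Z)) W p"
    using V g_D[of X "T Y Z" W p] D_T[of X Y Z] by (simp add: g_add_left T_in D_in)
  \<comment> \<open>In this form the term cancels the quadratic term that
    \<open>g_T_D_second\<close> contributes from \<open>T X (D Y Z)\<close>.\<close>
  moreover have "ap2 g (T X (T Y Z)) W p = ap2 g (T Y Z) (T W X) p"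
    using V T_cyclic[of W X "T Y Z" p] T_cyclic[of X "T Y Z" W p]
    by (simp add: g_sym[of "T Y Z"] T_in)
  ultimately show ?thesis
    using V by (simp add: g_T_D_first g_T_D_second algebra_simps)
qed

lemma g_T_T_skew:
  assumes V: "X \<in> vf" "Y \<in> vf" "Z \<in> vf" "W \<in> vf"
  shows "ap2 g (T X Y) (T Z W) p = - ap2 g (T Y X) (T Z W) p"
    and "ap2 g (T X Y) (T Z W) p = - ap2 g (T X Y) (T W Z) p"
  using T_skew12[OF V(1,2) T_in[OF V(3,4)]] T_skew12[OF V(3,4) T_in[OF V(1,2)]]
    g_sym[OF T_in[OF V(1,2)] T_in[OF V(3,4)]] g_sym[OF T_in[OF V(1,2)] T_in[OF V(4,3)]]
  by metis+

text \<open>Skew-symmetrizing \<open>g_D_D\<close> yields \<open>g (T X Y) (T Z W)\<close> with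
  factor 1/2. It is split into two quarters so that one of them completes the cyclic sum.\<close>

lemma curvature4_D:
  assumes V: "X \<in> vf" "Y \<in> vf" "Z \<in> vf" "W \<in> vf"
  shows "curvature4 g D X Y Z W p = curvature4 g nabla X Y Z W p
    + 1/4 * ap2 g (T X Y) (T Z W) p
    + 1/4 * (ap2 g (T X Y) (T Z W) p + ap2 g (T Y Z) (T X W) p + ap2 g (T Z X) (T Y W) p)"
proof -
  \<comment> \<open>Torsion-freeness makes the half with \<open>T\<close> exactly the first-order
    remainder of the two second derivatives.\<close>
  have r: "ap2 g (D (Lie_bracket X Y) Z) W p = ap2 g (nabla (Lie_bracket X Y) Z) W p
      + 1/2 * (ap2 g (nabla X Y) (T Z W) p - ap2 g (nabla Y X) (T Z W) p)"
    using V T_cyclic[of "Lie_bracket X Y" Z W p]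
    by (simp add: g_D Lie_bracket_in g_sym[of "T Z W"] T_in)
      (simp add: torsion_free g_diff_left nabla_in T_in)
  have s: "ap2 g (T Y X) (T Z W) p = - ap2 g (T X Y) (T Z W) p"
      "ap2 g (T X Z) (T W Y) p = ap2 g (T Z X) (T Y W) p"
      "ap2 g (T Y Z) (T W X) p = - ap2 g (T Y Z) (T X W) p"
    using V g_T_T_skew(1)[of Y X Z W p] g_T_T_skew(1)[of X Z W Y p] g_T_T_skew(2)[of Z X W Y p]
      g_T_T_skew(2)[of Y Z W X p] by simp_all
  show ?thesis
    unfolding curvature4_def curvature_def
    using V by (simp add: g_diff_left nabla_in D_in Lie_bracket_in diff_in g_D_D r s)
      (simp add: field_simps)
qed

text \<open>In the cyclic sum of \<open>curvature4_D\<close> the Riemannian part drops out; the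
  single quarters give S/4 and the three cyclic sums 3S/4, hence S = 0.\<close>

lemma curvature4_D_Bianchi:
  assumes V: "X \<in> vf" "Y \<in> vf" "Z \<in> vf" "W \<in> vf"
    and K: "curvature4 g D X Y Z W p + curvature4 g D Y Z X W p + curvature4 g D Z X Y W p = 0"
  shows "curvature4 g D X Y Z W p = curvature4 g nabla X Y Z W p + 1/4 * ap2 g (T X Y) (T Z W) p"
  using K curvature4_Bianchi[OF V, of p] V by (simp add: curvature4_D field_simps)

end

section \<open>Almost contact B-metric manifolds\<close>

locale B_metric_manifold =
  fixes n :: nat
    and A :: "('m::{t2_space, second_countable_topology}, 'e::euclidean_space) atlas"
    and \<phi> :: "'m endo_field" and \<xi> :: "'m vfield" and \<eta> :: "'m form_field"
    and g :: "'m metric_field" and nabla :: "'m connection"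
  assumes B_metric: "almost_contact_B_metric n A \<phi> \<xi> \<eta> g"
    and Levi_Civita: "Levi_Civita A g nabla"
begin

sublocale metric_manifold A g nabla n "n + 1"
  using B_metric Levi_Civita by unfold_locales (simp_all add: almost_contact_B_metric_def)

lemma xi_in: "\<xi> \<in> vf"
  using B_metric by (simp add: almost_contact_B_metric_def)

lemma phi_in: "X \<in> vf \<Longrightarrow> ap1 \<phi> X \<in> vf"
  using B_metric by (simp add: almost_contact_B_metric_def endomorphism_field_def)

lemma eta_smooth: "X \<in> vf \<Longrightarrow> ap1 \<eta> X \<in> smooth_functions A"
  using B_metric by (simp add: almost_contact_B_metric_def one_form_def)

sublocale pointwise: contact_space "tangent_space A p" "\<phi> p" "\<xi> p" "\<eta> p" for p
proof
  show "\<phi> p u \<in> tangent_space A p" if "u \<in> tangent_space A p" for u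
    using B_metric that by (auto simp: almost_contact_B_metric_def endomorphism_field_def)
qed (use B_metric xi_in in \<open>auto simp: almost_contact_B_metric_def tangent_space_add
    tangent_space_scaleR vector_fields_in\<close>)

lemma eta_phi: "X \<in> vf \<Longrightarrow> \<eta> p (\<phi> p (X p)) = 0"
  by (simp add: pointwise.h_f vector_fields_in)

lemma phi_phi: "X \<in> vf \<Longrightarrow> ap1 \<phi> (ap1 \<phi> X) = - X + ap1 \<eta> X \<cdot> \<xi>"
  by (simp add: ap1_def fscale_def fun_eq_iff[where 'a='m] pointwise.f_f vector_fields_in)

lemma ap1_apply: "ap1 S X p = S p (X p)"
  by (simp add: ap1_def)

text \<open>Put \<xi> into the second slot of the B-metric identity; \<phi> \<xi> = 0 makes its left
  side vanish.\<close>

lemma g_xi: "X \<in> vf \<Longrightarrow> ap2 g X \<xi> p = \<eta> p (X p)"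
proof -
  assume X: "X \<in> vf"
  have "g p (\<phi> p (X p)) (\<phi> p (\<xi> p)) = - g p (X p) (\<xi> p) + \<eta> p (X p) * \<eta> p (\<xi> p)"
    using B_metric vector_fields_in[OF X] vector_fields_in[OF xi_in]
    unfolding almost_contact_B_metric_def by blast
  moreover have "g p (\<phi> p (X p)) 0 = 0"
    using g_scaleR_right[OF X phi_in[OF X], of 0 p] by (simp add: ap2_def ap1_apply)
  ultimately show ?thesis by (simp add: pointwise.f_e pointwise.h_e ap2_def)
qed

text \<open>The function g(\<xi>, \<xi>) is constantly 1, and its derivative is twice this
  value.\<close>

lemma g_nabla_xi_xi: "X \<in> vf \<Longrightarrow> ap2 g (nabla X \<xi>) \<xi> p = 0"
proof -
  assume X: "X \<in> vf"
  have "ap2 g \<xi> \<xi> = (\<lambda>_. 1)"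
    by (simp add: fun_eq_iff g_xi xi_in pointwise.h_e)
  then show ?thesis
    using metric_compatible[OF X xi_in xi_in, of p] g_sym[OF xi_in nabla_in[OF X xi_in], of p]
      vector_fields_apply_const[OF X] by simp
qed

lemma cov_form_eta:
  assumes "X \<in> vf" "Y \<in> vf"
  shows "cov_form nabla \<eta> X Y p = ap2 g (nabla X \<xi>) Y p"
proof -
  have "ap1 \<eta> Y = ap2 g Y \<xi>" using assms by (simp add: fun_eq_iff g_xi ap1_apply)
  then show ?thesis
    using metric_compatible[OF assms xi_in, of p] assms g_sym[OF assms(2) nabla_in[OF assms(1) xi_in]]
    by (simp add: cov_form_def g_xi nabla_in xi_in ap1_apply)
qed

text \<open>Pair the derivative of \<phi> applied to \<phi> y with \<xi>: the part in the image of
  \<phi> is orthogonal to \<xi>, and differentiating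
  \<open>\<phi>\<^sup>2 y = - y + \<eta>(y) \<xi>\<close> leaves the covariant derivative of
  \<eta>.\<close>

lemma fundamental_F_xi:
  assumes V: "X \<in> vf" "Y \<in> vf"
  shows "fundamental_F g nabla \<phi> X (ap1 \<phi> Y) \<xi> p = ap2 g (nabla X \<xi>) Y p"
proof -
  let ?f = "\<lambda>p. X p (ap1 \<eta> Y)"
  have f: "?f \<in> smooth_functions A" using V by (simp add: vector_fields_apply eta_smooth)
  have "nabla X (ap1 \<phi> (ap1 \<phi> Y)) = - nabla X Y + (?f \<cdot> \<xi> + ap1 \<eta> Y \<cdot> nabla X \<xi>)"
    using V by (simp add: phi_phi nabla_add nabla_diff nabla_fscale fscale_in
        eta_smooth xi_in)
  then have "fundamental_F g nabla \<phi> X (ap1 \<phi> Y) \<xi> p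
      = - ap2 g (nabla X Y) \<xi> p + (?f p * ap2 g \<xi> \<xi> p + ap1 \<eta> Y p * ap2 g (nabla X \<xi>) \<xi> p)
        - ap2 g (ap1 \<phi> (nabla X (ap1 \<phi> Y))) \<xi> p"
    using V f by (simp add: fundamental_F_def cov_endo_def g_diff_left g_add_left
        g_fscale_left add_in diff_in fscale_in phi_in nabla_in xi_in eta_smooth)
  also have "\<dots> = cov_form nabla \<eta> X Y p"
    using V g_nabla_xi_xi[OF V(1), of p]
    by (simp add: g_xi cov_form_def nabla_in xi_in phi_in pointwise.h_e
        eta_phi ap1_apply)
  finally show ?thesis using V by (simp add: cov_form_eta)
qed

lemma cov_endo_in: "X \<in> vf \<Longrightarrow> Y \<in> vf \<Longrightarrow> cov_endo nabla \<phi> X Y \<in> vf"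
  by (simp add: cov_endo_def diff_in nabla_in phi_in)

lemma cov_form_smooth: "X \<in> vf \<Longrightarrow> Y \<in> vf \<Longrightarrow> cov_form nabla \<eta> X Y \<in> smooth_functions A"
  using smooth_functions_diff[OF atlas vector_fields_apply[OF _ eta_smooth] eta_smooth[OF nabla_in]]
  by (simp add: cov_form_def)

text \<open>A fixed operation given by the formula for \<open>T\<close>; the \<open>T\<close> of the
  theorem agrees with it on vector fields.\<close>

definition torsion :: "'m vfield \<Rightarrow> 'm vfield \<Rightarrow> 'm vfield" where
  "torsion x y = (1/2) *\<^sub>R
    (2 *\<^sub>R cov_endo nabla \<phi> x (ap1 \<phi> y)
     - cov_endo nabla \<phi> y (ap1 \<phi> x)
     + cov_endo nabla \<phi> (ap1 \<phi> y) x
     + 3 *\<^sub>R (ap1 \<eta> x \<cdot> nabla y \<xi>)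
     - 4 *\<^sub>R (ap1 \<eta> y \<cdot> nabla x \<xi>)
     + 2 *\<^sub>R (cov_form nabla \<eta> x y \<cdot> \<xi>))"

lemmas torsion_closure = cov_endo_in cov_form_smooth phi_in fscale_in scaleR_in add_in diff_in nabla_in
  xi_in eta_smooth

lemma torsion_in: "x \<in> vf \<Longrightarrow> y \<in> vf \<Longrightarrow> torsion x y \<in> vf"
  by (simp add: torsion_def torsion_closure)

text \<open>This passes from fields to values at \<open>p\<close>. The tensor \<open>F\<close> only
  has to represent the fundamental tensor at this one point, so the sum of F' and F'' may be
  inserted.\<close>

lemma g_torsion:
  assumes V: "x \<in> vf" "y \<in> vf" "z \<in> vf"
    and F: "\<And>x y z. x \<in> vf \<Longrightarrow> y \<in> vf \<Longrightarrow> z \<in> vf \<Longrightarrow>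
      fundamental_F g nabla \<phi> x y z p = F (x p) (y p) (z p)"
  shows "ap2 g (torsion x y) z p = torsion_form (\<phi> p) (\<xi> p) (\<eta> p) F (x p) (y p) (z p)"
proof -
  have e: "ap2 g (cov_endo nabla \<phi> x y) z p = F (x p) (y p) (z p)"
    if "x \<in> vf" "y \<in> vf" "z \<in> vf" for x y z
    using F[OF that] by (simp add: fundamental_F_def)
  have x: "ap2 g (nabla x \<xi>) y p = F (x p) (\<phi> p (y p)) (\<xi> p)" if "x \<in> vf" "y \<in> vf" for x y
    using fundamental_F_xi[OF that, of p] F[OF that(1) phi_in[OF that(2)] xi_in]
    by (simp add: ap1_apply)
  have "ap2 g (torsion x y) z p = 1/2 * (2 * ap2 g (cov_endo nabla \<phi> x (ap1 \<phi> y)) z p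
     - ap2 g (cov_endo nabla \<phi> y (ap1 \<phi> x)) z p
     + ap2 g (cov_endo nabla \<phi> (ap1 \<phi> y) x) z p
     + 3 * (ap1 \<eta> x p * ap2 g (nabla y \<xi>) z p)
     - 4 * (ap1 \<eta> y p * ap2 g (nabla x \<xi>) z p)
     + 2 * (cov_form nabla \<eta> x y p * ap2 g \<xi> z p))"
    unfolding torsion_def using V
    by (simp add: g_add_left g_diff_left g_scaleR_left g_fscale_left torsion_closure)
  then show ?thesis
    using e[OF V(1) phi_in[OF V(2)] V(3)] e[OF V(2) phi_in[OF V(1)] V(3)]
      e[OF phi_in[OF V(2)] V(1,3)] x[OF V(2,3)] x[OF V(1,3)] x[OF V(1,2)]
      cov_form_eta[OF V(1,2), of p] g_xi[OF V(3), of p] g_sym[OF xi_in V(3), of p]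
    by (simp add: torsion_form_def ap1_apply)
qed

end

locale F3_F7_manifold = B_metric_manifold n A \<phi> \<xi> \<eta> g nabla
  for n :: nat
    and A :: "('m::{t2_space, second_countable_topology}, 'e::euclidean_space) atlas"
    and \<phi> \<xi> \<eta> g nabla +
  assumes F3_F7: "in_F3_F7 A \<phi> \<xi> \<eta> g nabla"
begin

text \<open>The decomposition is given only existentially at each point, so the form is obtained
  separately for each \<open>p\<close>. The third fact adds the values of the F3 and F7 parts at
  \<xi>.\<close>

lemma torsion_skew:
  obtains F where "skew_form_on (tangent_space A p) F"
    and "\<And>x y z. x \<in> vf \<Longrightarrow> y \<in> vf \<Longrightarrow> z \<in> vf \<Longrightarrow> ap2 g (torsion x y) z p = F (x p) (y p) (z p)"
    and "\<And>x z. x \<in> vf \<Longrightarrow> z \<in> vf \<Longrightarrow> F (x p) (\<xi> p) (z p) = - 2 * ap2 g (nabla x \<xi>) z p"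
proof -
  obtain F' F'' where F: "trilinear_form_on (tangent_space A p) F'"
      "property_P (tangent_space A p) (\<phi> p) (\<xi> p) (\<eta> p) F'"
      "class_F3 (tangent_space A p) (\<xi> p) F'"
    and G: "trilinear_form_on (tangent_space A p) F''"
      "property_P (tangent_space A p) (\<phi> p) (\<xi> p) (\<eta> p) F''"
      "class_F7 (tangent_space A p) (\<phi> p) F''"
    and all: "\<forall>X\<in>vf. \<forall>Y\<in>vf. \<forall>Z\<in>vf.
      fundamental_F g nabla \<phi> X Y Z p = F' (X p) (Y p) (Z p) + F'' (X p) (Y p) (Z p)"
    using spec[OF F3_F7[unfolded in_F3_F7_def], of p] by (elim exE conjE) (rule that)
  then have sum: "fundamental_F g nabla \<phi> X Y Z p = F' (X p) (Y p) (Z p) + F'' (X p) (Y p) (Z p)"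
    if "X \<in> vf" "Y \<in> vf" "Z \<in> vf" for X Y Z
    using that by blast
  let ?t = "torsion_form (\<phi> p) (\<xi> p) (\<eta> p)"
  show thesis
  proof (rule that)
    show "skew_form_on (tangent_space A p) (\<lambda>x y z. ?t F' x y z + ?t F'' x y z)"
      by (rule skew_form_on_add[OF pointwise.F3_skew[OF F] pointwise.F7_skew[OF G]])
    show "ap2 g (torsion x y) z p = ?t F' (x p) (y p) (z p) + ?t F'' (x p) (y p) (z p)"
      if "x \<in> vf" "y \<in> vf" "z \<in> vf" for x y z
      using g_torsion[OF that, of p "\<lambda>x y z. F' x y z + F'' x y z"] sum
      by (simp add: torsion_form_add)
    show "?t F' (x p) (\<xi> p) (z p) + ?t F'' (x p) (\<xi> p) (z p) = - 2 * ap2 g (nabla x \<xi>) z p"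
      if "x \<in> vf" "z \<in> vf" for x z
      using fundamental_F_xi[OF that, of p] sum[OF that(1) phi_in[OF that(2)] xi_in]
        pointwise.F3_e[OF F that[THEN vector_fields_in]]
        pointwise.F7_e[OF G that[THEN vector_fields_in]]
      by (simp add: ap1_apply)
  qed
qed

lemma torsion_skew12:
  assumes "x \<in> vf" "y \<in> vf" "z \<in> vf"
  shows "ap2 g (torsion x y) z p = - ap2 g (torsion y x) z p"
proof (rule torsion_skew[of p])
  fix F
  assume skew: "skew_form_on (tangent_space A p) F"
    and F: "\<And>x y z. x \<in> vf \<Longrightarrow> y \<in> vf \<Longrightarrow> z \<in> vf \<Longrightarrow>
      ap2 g (torsion x y) z p = F (x p) (y p) (z p)"
  from skew have "F (x p) (y p) (z p) = - F (y p) (x p) (z p)"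
    using assms[THEN vector_fields_in] unfolding skew_form_on_def by blast
  then show ?thesis using assms by (simp add: F)
qed

lemma torsion_skew23:
  assumes "x \<in> vf" "y \<in> vf" "z \<in> vf"
  shows "ap2 g (torsion x y) z p = - ap2 g (torsion x z) y p"
proof (rule torsion_skew[of p])
  fix F
  assume skew: "skew_form_on (tangent_space A p) F"
    and F: "\<And>x y z. x \<in> vf \<Longrightarrow> y \<in> vf \<Longrightarrow> z \<in> vf \<Longrightarrow>
      ap2 g (torsion x y) z p = F (x p) (y p) (z p)"
  from skew have "F (x p) (y p) (z p) = - F (x p) (z p) (y p)"
    using assms[THEN vector_fields_in] unfolding skew_form_on_def by blast
  then show ?thesis using assms by (simp add: F)
qed

text \<open>This is \<open>D \<xi> = 0\<close>.\<close>

lemma torsion_xi: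
  assumes "x \<in> vf" "z \<in> vf"
  shows "ap2 g (torsion x \<xi>) z p = - 2 * ap2 g (nabla x \<xi>) z p"
  by (rule torsion_skew[of p]) (simp add: assms xi_in)

end

section \<open>The two curvature identities from the \<phi>-Kaehler condition\<close>

theorem proposition10:
  fixes n :: nat
    and A :: "('m::{t2_space, second_countable_topology}, 'e::euclidean_space) atlas"
    and \<phi> :: "'m endo_field" and \<xi> :: "'m vfield" and \<eta> :: "'m form_field"
    and g :: "'m metric_field"
    and nabla D :: "'m connection"
    and T :: "'m vfield \<Rightarrow> 'm vfield \<Rightarrow> 'm vfield"
  assumes "almost_contact_B_metric n A \<phi> \<xi> \<eta> g"
    and "Levi_Civita A g nabla"
    and "in_F3_F7 A \<phi> \<xi> \<eta> g nabla"
    and T_formula: "\<And>x y. x \<in> vector_fields A \<Longrightarrow> y \<in> vector_fields A \<Longrightarrow>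
      T x y = (1/2) *\<^sub>R
        (2 *\<^sub>R cov_endo nabla \<phi> x (ap1 \<phi> y)
         - cov_endo nabla \<phi> y (ap1 \<phi> x)
         + cov_endo nabla \<phi> (ap1 \<phi> y) x
         + 3 *\<^sub>R (ap1 \<eta> x \<cdot> nabla y \<xi>)
         - 4 *\<^sub>R (ap1 \<eta> y \<cdot> nabla x \<xi>)
         + 2 *\<^sub>R (cov_form nabla \<eta> x y \<cdot> \<xi>))"
    and D_formula: "\<And>x y. x \<in> vector_fields A \<Longrightarrow> y \<in> vector_fields A \<Longrightarrow>
      D x y = nabla x y + (1/2) *\<^sub>R T x y"
    and "parallel_torsion A D T"
    and "phi_Kaehler_type A \<phi> (curvature4 g D)"
  shows "\<forall>x\<in>vector_fields A. \<forall>y\<in>vector_fields A. \<forall>z\<in>vector_fields A. \<forall>w\<in>vector_fields A. \<forall>p.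
      curvature4 g nabla x y (ap1 \<phi> z) (ap1 \<phi> w) p
        = - curvature4 g nabla x y z w p
          - 1/4 * ap2 g (T x y) (T z w + T (ap1 \<phi> z) (ap1 \<phi> w)) p
    \<and> curvature4 g nabla x y z \<xi> p = 1/2 * ap2 g (T x y) (nabla z \<xi>) p"
proof -
  interpret F3_F7_manifold n A \<phi> \<xi> \<eta> g nabla
    using assms(1-3) by unfold_locales
  have T: "T x y = torsion x y" if "x \<in> vf" "y \<in> vf" for x y
    using T_formula[OF that] by (simp add: torsion_def)
  interpret skew_torsion A g nabla n "n + 1" D T
  proof
    fix X Y Z p assume V: "X \<in> vf" "Y \<in> vf"
    show "T X Y \<in> vf" using V by (simp add: T torsion_in)
    show "D X Y = nabla X Y + (1/2) *\<^sub>R T X Y" using V by (rule D_formula)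
    assume "Z \<in> vf"
    with V show "ap2 g (T X Y) Z p = - ap2 g (T Y X) Z p"
      "ap2 g (T X Y) Z p = - ap2 g (T X Z) Y p"
      using torsion_skew12[of X Y Z p] torsion_skew23[of X Y Z p] by (simp_all add: T)
  qed (rule assms(6))
  have K_cyclic: "curvature4 g D x y z w p + curvature4 g D y z x w p + curvature4 g D z x y w p = 0"
    and K_phi: "curvature4 g D x y (ap1 \<phi> z) (ap1 \<phi> w) p = - curvature4 g D x y z w p"
    if "x \<in> vf" "y \<in> vf" "z \<in> vf" "w \<in> vf" for x y z w p
    using assms(7) that unfolding phi_Kaehler_type_def by blast+
  have K: "curvature4 g D x y z w p
      = curvature4 g nabla x y z w p + 1/4 * ap2 g (T x y) (T z w) p"
    if "x \<in> vf" "y \<in> vf" "z \<in> vf" "w \<in> vf" for x y z w p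
    by (rule curvature4_D_Bianchi[OF that K_cyclic[OF that]])
  show ?thesis
  proof (intro ballI allI conjI)
    fix x y z w p assume V: "x \<in> vf" "y \<in> vf" "z \<in> vf" "w \<in> vf"
    \<comment> \<open>Expressing both sides of \<open>K_phi\<close> by \<open>K\<close> leaves two
      quadratic terms, which additivity of \<open>g\<close> collects into one slot.\<close>
    show "curvature4 g nabla x y (ap1 \<phi> z) (ap1 \<phi> w) p
        = - curvature4 g nabla x y z w p
          - 1/4 * ap2 g (T x y) (T z w + T (ap1 \<phi> z) (ap1 \<phi> w)) p"
      using K_phi[OF V, of p] K[OF V, of p] K[OF V(1,2) phi_in[OF V(3)] phi_in[OF V(4)], of p]
        g_add_right[OF T_in[OF V(3,4)] T_in[OF phi_in[OF V(3)] phi_in[OF V(4)]] T_in[OF V(1,2)], of p]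
      by (simp add: algebra_simps)
    have in_vf: "curvature D x y (ap1 \<phi> z) \<in> vf"
      using V by (simp add: curvature_def diff_in D_in Lie_bracket_in phi_in)
    \<comment> \<open>Since \<phi> \<xi> = 0, the \<phi>-invariance of the curvature of
      \<open>D\<close> forces it to vanish with \<xi> in the last slot, so only the quadratic term
      remains.\<close>
    have "ap1 \<phi> \<xi> p = 0" by (simp add: ap1_apply pointwise.f_e)
    then have "curvature4 g D x y (ap1 \<phi> z) (ap1 \<phi> \<xi>) p = 0"
      using g_scaleR_right[OF xi_in in_vf, of 0 p] by (simp add: curvature4_def ap2_def)
    then have "curvature4 g nabla x y z \<xi> p = - 1/4 * ap2 g (T x y) (T z \<xi>) p"
      using K_phi[OF V(1-3) xi_in, of p] K[OF V(1-3) xi_in, of p] by simp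
    \<comment> \<open>By symmetry of \<open>g\<close>, \<open>torsion_xi\<close> applies with
      \<open>T x y\<close> as the test field; the factor - 2 turns - 1/4 into 1/2.\<close>
    also have "ap2 g (T x y) (T z \<xi>) p = - 2 * ap2 g (T x y) (nabla z \<xi>) p"
      using V torsion_xi[OF V(3) T_in[OF V(1,2)], of p]
      by (simp add: T xi_in torsion_in nabla_in g_sym[of "torsion x y"])
    finally show "curvature4 g nabla x y z \<xi> p = 1/2 * ap2 g (T x y) (nabla z \<xi>) p" by simp
  qed
qed

end
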